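(* Let $\Omega\subset D_m$ be generic, $\Lambda=\{(t,x_t):t\in\mathbb{R}_+,x\in\Omega\}$, and let $M\in\mathcal{M}(\Lambda)$ be a functional of class $\mathcal{M}$. If there exists $T>0$ such that $$\forall x\in\Omega,\qquad M(T,x_T)-M(0,x_0)\ge0,$$ then $$\forall x\in\Omega,\qquad M(T,x_T)=M(0,x_0).$$
   Context: Partitions: $\pi=(\pi_n)_{n\ge1}$ is a fixed sequence of partitions $\pi_n=(0=t^n_0<\dots<t^n_{k_n}<\infty)$ of $[0,\infty)$ with $t^n_{k_n}\to\infty$ and mesh vanishing on compacts; the superscript $n$ is dropped and sums involving $t_{i+1}$ run over $i<k_n$. Paths: $D_m$ is the space of càdlàg functions $[0,\infty)\to\mathbb{R}^m$, $x(0-):=x(0)$, $\Delta x(t):=x(t)-x(t-)$; $x_t(s):=x(s\wedge t)$, $x_{t-}(s):=x(s)1_{s<t}+x(t-)1_{s\ge t}$. $x^n:=\sum_{t_i\in\pi_n}x(t_{i+1})1_{[t_i,t_{i+1})}$, and $x^n_t,x^n_{t-}$ are the stopped versions of $x^n$. Generic sets: a nonempty $\Omega\subset D_m$ is generic if (i) for every $x\in\Omega$, $T>0$ there is $N=N_T(x)$ with $x^n_T\in\Omega$ for all $n\ge N$; (ii) for every $x\in\Omega$, $t\ge0$ there is a convex neighbourhood $\mathcal{U}$ of $0$ in $\mathbb{R}^m$ with $-\Delta x(t)\in\mathcal{U}$ and $x_t+e1_{[t,\infty)}\in\Omega$ for all $e\in\mathcal{U}$. Continuity of functionals $F$ on $\Lambda$: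 let $t'_n:=\max\{t_i<t:t_i\in\pi_n\}$ (and $0$ if there is no such $t_i$). $F$ is left-continuous if for all $(t,x_t)\in\Lambda$ ($x\in\Omega$): 1(a) $\lim_{s\uparrow t,\,s\le t}F(s,x_{s-})=F(t,x_{t-})$; 1(b) $\lim_{s\uparrow t,\,s<t}F(s,x_s)=F(t,x_{t-})$; 1(c) $t_n\to t$, $t_n\le t'_n$ implies $F(t_n,x^n_{t_n-})\to F(t,x_{t-})$; 1(d) $t_n\to t$, $t_n<t'_n$ implies $F(t_n,x^n_{t_n})\to F(t,x_{t-})$. $F$ is right-continuous if for all such $(t,x_t)$: 2(a) $\lim_{s\downarrow t,\,s\ge t}F(s,x_s)=F(t,x_t)$; 2(b) $\lim_{s\downarrow t,\,s>t}F(s,x_{s-})=F(t,x_t)$; 2(c) $t_n\to t$, $t_n\ge t'_n$ implies $F(t_n,x^n_{t_n})\to F(t,x_t)$; 2(d) $t_n\to t$, $t_n>t'_n$ implies $F(t_n,x^n_{t_n-})\to F(t,x_t)$. $F$ is continuous if it is both left- and right-continuous. Vector-valued functionals: componentwise. Derivatives: $\mathcal{D}F(t,x_t):=\lim_{h\downarrow0}\frac{F(t+h,x_t)-F(t,x_t)}{h}$; $\nabla_xF(t,x_t)$ is the gradient at $e=0$ of $e\mapsto F(t,x_t+e1_{[t,\infty)})$. $F$ is differentiable if both exist at every point of $\Lambda$. $F$ is strictly causal if $F(t,x_t)=F(t,x_{t-})$ for all $(t,x_t)\in\Lambda$. Class $\mathcal{M}(\Lambda)$: continuous differentiable $F:\Lambda\to\mathbb{R}$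 such that $\mathcal{D}F=0$ and $\nabla_xF$ is left-continuous and strictly causal. *)

theory Defs
  imports "HOL-Analysis.Analysis"
begin

text \<open>
  A path on \<open>[0,\<infinity>)\<close> is represented by a function on the whole real line that vanishes
  on the negative half-line, so that equality of functions is equality of paths.  All
  operations on paths below preserve this convention when taken at times \<open>t \<ge> 0\<close>.
\<close>

type_synonym 'm rpath = "real \<Rightarrow> real ^ 'm"

definition cadlag :: "('m::finite) rpath set" where
  "cadlag = {x. (\<forall>t<0. x t = 0) \<and>
                (\<forall>t\<ge>0. (x \<longlongrightarrow> x t) (at_right t)) \<and>
                (\<forall>t>0. \<exists>l. (x \<longlongrightarrow> l) (at_left t))}"

definition left_lim :: "('m::finite) rpath \<Rightarrow> real \<Rightarrow> real ^ 'm" where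
  "left_lim x t = (if t \<le> 0 then x 0 else Lim (at_left t) x)"

definition jump :: "('m::finite) rpath \<Rightarrow> real \<Rightarrow> real ^ 'm" where
  "jump x t = x t - left_lim x t"

definition stopped :: "('m::finite) rpath \<Rightarrow> real \<Rightarrow> 'm rpath" where
  "stopped x t = (\<lambda>s. x (min s t))"

definition stopped_left :: "('m::finite) rpath \<Rightarrow> real \<Rightarrow> 'm rpath" where
  "stopped_left x t = (\<lambda>s. if s < t then x s else left_lim x t)"

text \<open>The path \<open>x + e 1\<^bsub>[t,\<infinity>)\<^esub>\<close>.\<close>

definition bump :: "('m::finite) rpath \<Rightarrow> real \<Rightarrow> real ^ 'm \<Rightarrow> 'm rpath" where
  "bump x t e = (\<lambda>s. x s + indicator {t..} s *\<^sub>R e)"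

text \<open>
  The \<open>n\<close>-th partition is \<open>P n 0 < \<dots> < P n (k n)\<close>; the values \<open>P n i\<close> with \<open>i > k n\<close> play
  no role.  Sequences of partitions are indexed from \<open>0\<close>.  The mesh on \<open>[0,T]\<close> is that of the
  partition truncated at \<open>T\<close>; it is a maximum over a nonempty set as soon as \<open>k n > 0\<close>, hence
  for all large \<open>n\<close>.
\<close>

definition partition_seq :: "(nat \<Rightarrow> nat \<Rightarrow> real) \<Rightarrow> (nat \<Rightarrow> nat) \<Rightarrow> bool" where
  "partition_seq P k \<longleftrightarrow>
     (\<forall>n. P n 0 = 0 \<and> (\<forall>i<k n. P n i < P n (Suc i))) \<and>
     filterlim (\<lambda>n. P n (k n)) at_top sequentially \<and>
     (\<forall>T>0. (\<lambda>n. Max ((\<lambda>i. min (P n (Suc i)) T - min (P n i) T) ` {..<k n})) \<longlonglongrightarrow> 0)"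

definition approx_path ::
  "(nat \<Rightarrow> nat \<Rightarrow> real) \<Rightarrow> (nat \<Rightarrow> nat) \<Rightarrow> ('m::finite) rpath \<Rightarrow> nat \<Rightarrow> 'm rpath" where
  "approx_path P k x n =
     (\<lambda>s. \<Sum>i<k n. indicator {P n i..<P n (Suc i)} s *\<^sub>R x (P n (Suc i)))"

definition prev_point :: "(nat \<Rightarrow> nat \<Rightarrow> real) \<Rightarrow> (nat \<Rightarrow> nat) \<Rightarrow> real \<Rightarrow> nat \<Rightarrow> real" where
  "prev_point P k t n =
     (if \<exists>i\<le>k n. P n i < t then Max {P n i | i. i \<le> k n \<and> P n i < t} else 0)"

definition generic ::
  "(nat \<Rightarrow> nat \<Rightarrow> real) \<Rightarrow> (nat \<Rightarrow> nat) \<Rightarrow> ('m::finite) rpath set \<Rightarrow> bool" where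
  "generic P k \<Omega> \<longleftrightarrow>
     \<Omega> \<noteq> {} \<and> \<Omega> \<subseteq> cadlag \<and>
     (\<forall>x\<in>\<Omega>. \<forall>T>0. \<exists>N. \<forall>n\<ge>N. stopped (approx_path P k x n) T \<in> \<Omega>) \<and>
     (\<forall>x\<in>\<Omega>. \<forall>t\<ge>0. \<exists>U. convex U \<and> 0 \<in> interior U \<and> - jump x t \<in> U \<and>
        (\<forall>e\<in>U. bump (stopped x t) t e \<in> \<Omega>))"

definition Lambda :: "('m::finite) rpath set \<Rightarrow> (real \<times> 'm rpath) set" where
  "Lambda \<Omega> = {(t, stopped x t) | t x. 0 \<le> t \<and> x \<in> \<Omega>}"

text \<open>
  A functional on \<open>Lambda \<Omega>\<close> is a function on all pairs whose values outside
  \<open>Lambda \<Omega>\<close> are irrelevant: for generic \<open>\<Omega>\<close>, every limit below only depends on values on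
  \<open>Lambda \<Omega>\<close>.  In particular \<open>(\<tau> n, stopped (approx_path P k x n) (\<tau> n))\<close>
  lies in \<open>Lambda \<Omega>\<close> only for large \<open>n\<close>, so the order conditions relating a sequence
  \<open>\<tau> n \<longlonglongrightarrow> t\<close> to the preceding partition points are also required only for large \<open>n\<close>.
  (Otherwise the last clause of left-continuity would be void at every \<open>t\<close> that lies before
  the first positive point of some partition.)
\<close>

definition left_cont ::
  "(nat \<Rightarrow> nat \<Rightarrow> real) \<Rightarrow> (nat \<Rightarrow> nat) \<Rightarrow> ('m::finite) rpath set
    \<Rightarrow> (real \<times> 'm rpath \<Rightarrow> real) \<Rightarrow> bool" where
  "left_cont P k \<Omega> F \<longleftrightarrow>
     (\<forall>t\<ge>0. \<forall>x\<in>\<Omega>.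
        ((\<lambda>s. F (s, stopped_left x s)) \<longlongrightarrow> F (t, stopped_left x t)) (at t within {0..t}) \<and>
        ((\<lambda>s. F (s, stopped x s)) \<longlongrightarrow> F (t, stopped_left x t)) (at t within {0..<t}) \<and>
        (\<forall>\<tau>. (\<forall>n. 0 \<le> \<tau> n) \<and> \<tau> \<longlonglongrightarrow> t \<and> (\<forall>\<^sub>F n in sequentially. \<tau> n \<le> prev_point P k t n) \<longrightarrow>
           (\<lambda>n. F (\<tau> n, stopped_left (approx_path P k x n) (\<tau> n))) \<longlonglongrightarrow> F (t, stopped_left x t)) \<and>
        (\<forall>\<tau>. (\<forall>n. 0 \<le> \<tau> n) \<and> \<tau> \<longlonglongrightarrow> t \<and> (\<forall>\<^sub>F n in sequentially. \<tau> n < prev_point P k t n) \<longrightarrow>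
           (\<lambda>n. F (\<tau> n, stopped (approx_path P k x n) (\<tau> n))) \<longlonglongrightarrow> F (t, stopped_left x t)))"

definition right_cont ::
  "(nat \<Rightarrow> nat \<Rightarrow> real) \<Rightarrow> (nat \<Rightarrow> nat) \<Rightarrow> ('m::finite) rpath set
    \<Rightarrow> (real \<times> 'm rpath \<Rightarrow> real) \<Rightarrow> bool" where
  "right_cont P k \<Omega> F \<longleftrightarrow>
     (\<forall>t\<ge>0. \<forall>x\<in>\<Omega>.
        ((\<lambda>s. F (s, stopped x s)) \<longlongrightarrow> F (t, stopped x t)) (at t within {t..}) \<and>
        ((\<lambda>s. F (s, stopped_left x s)) \<longlongrightarrow> F (t, stopped x t)) (at t within {t<..}) \<and>
        (\<forall>\<tau>. (\<forall>n. 0 \<le> \<tau> n) \<and> \<tau> \<longlonglongrightarrow> t \<and> (\<forall>\<^sub>F n in sequentially. \<tau> n \<ge> prev_point P k t n) \<longrightarrow>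
           (\<lambda>n. F (\<tau> n, stopped (approx_path P k x n) (\<tau> n))) \<longlonglongrightarrow> F (t, stopped x t)) \<and>
        (\<forall>\<tau>. (\<forall>n. 0 \<le> \<tau> n) \<and> \<tau> \<longlonglongrightarrow> t \<and> (\<forall>\<^sub>F n in sequentially. \<tau> n > prev_point P k t n) \<longrightarrow>
           (\<lambda>n. F (\<tau> n, stopped_left (approx_path P k x n) (\<tau> n))) \<longlonglongrightarrow> F (t, stopped x t)))"

definition has_time_deriv :: "(real \<times> ('m::finite) rpath \<Rightarrow> real) \<Rightarrow> real \<Rightarrow> real \<times> 'm rpath \<Rightarrow> bool" where
  "has_time_deriv F d = (\<lambda>(t, y). ((\<lambda>h. (F (t + h, y) - F (t, y)) / h) \<longlongrightarrow> d) (at_right 0))"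

definition has_space_grad ::
  "(real \<times> ('m::finite) rpath \<Rightarrow> real) \<Rightarrow> real ^ 'm \<Rightarrow> real \<times> 'm rpath \<Rightarrow> bool" where
  "has_space_grad F g = (\<lambda>(t, y). GDERIV (\<lambda>e. F (t, bump y t e)) 0 :> g)"

definition time_deriv :: "(real \<times> ('m::finite) rpath \<Rightarrow> real) \<Rightarrow> real \<times> 'm rpath \<Rightarrow> real" where
  "time_deriv F p = (THE d. has_time_deriv F d p)"

definition space_grad :: "(real \<times> ('m::finite) rpath \<Rightarrow> real) \<Rightarrow> real \<times> 'm rpath \<Rightarrow> real ^ 'm" where
  "space_grad F p = (THE g. has_space_grad F g p)"

definition differentiable_functional ::
  "('m::finite) rpath set \<Rightarrow> (real \<times> 'm rpath \<Rightarrow> real) \<Rightarrow> bool" where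
  "differentiable_functional \<Omega> F \<longleftrightarrow>
     (\<forall>p\<in>Lambda \<Omega>. (\<exists>d. has_time_deriv F d p) \<and> (\<exists>g. has_space_grad F g p))"

definition strictly_causal :: "('m::finite) rpath set \<Rightarrow> (real \<times> 'm rpath \<Rightarrow> 'b) \<Rightarrow> bool" where
  "strictly_causal \<Omega> F \<longleftrightarrow> (\<forall>t\<ge>0. \<forall>x\<in>\<Omega>. F (t, stopped x t) = F (t, stopped_left x t))"

definition class_M ::
  "(nat \<Rightarrow> nat \<Rightarrow> real) \<Rightarrow> (nat \<Rightarrow> nat) \<Rightarrow> ('m::finite) rpath set
    \<Rightarrow> (real \<times> 'm rpath \<Rightarrow> real) set" where
  "class_M P k \<Omega> =
     {F. left_cont P k \<Omega> F \<and> right_cont P k \<Omega> F \<and>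
         differentiable_functional \<Omega> F \<and>
         (\<forall>p\<in>Lambda \<Omega>. time_deriv F p = 0) \<and>
         (\<forall>i. left_cont P k \<Omega> (\<lambda>p. space_grad F p $ i)) \<and>
         strictly_causal \<Omega> (space_grad F)}"

end

theory Submission
  imports Defs
begin

text \<open>
  Since the time derivative of \<open>M\<close> vanishes, \<open>M\<close> is constant along flat stretches of a path, and
  since the gradient is strictly causal, \<open>M\<close> jumps at \<open>t\<close> by \<open>\<nabla>M(t, x\<^bsub>t-\<^esub>) \<bullet> \<Delta>x(t)\<close>.  As long
  as \<open>M(t, x\<^bsub>t-\<^esub>)\<close> still has its initial value, this gradient is zero: otherwise a small jump of
  \<open>x\<^bsub>t-\<^esub>\<close> against the gradient, with the path frozen afterwards, would produce a loss at time \<open>T\<close>.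
  Hence \<open>M\<close> is constant on \<open>[0,T]\<close> along piecewise constant paths, in particular along the
  approximations \<open>x\<^sup>n\<close>, and right-continuity passes this on to \<open>x\<close>.
\<close>

section \<open>Functions with vanishing right derivative\<close>

text \<open>Only one-sided derivatives are at hand, so the mean value theorem gives way to
  continuous induction. Left limits carry the bound to the supremum \<open>c\<close> of the good
  points, and if \<open>c < b\<close> the right derivative at \<open>c\<close> would carry it
  further.\<close>

lemma right_derivative_zero_le:
  fixes f :: "real \<Rightarrow> real"
  assumes "a \<le> b" and "e > 0"
    and right: "\<And>u. a \<le> u \<Longrightarrow> u < b \<Longrightarrow> ((\<lambda>h. (f (u + h) - f u) / h) \<longlongrightarrow> 0) (at_right 0)"
    and left: "\<And>u. a < u \<Longrightarrow> u \<le> b \<Longrightarrow> (f \<longlongrightarrow> f u) (at_left u)"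
  shows "\<bar>f b - f a\<bar> \<le> e * (b - a)"
proof -
  define S where "S = {u\<in>{a..b}. \<forall>v\<in>{a..u}. \<bar>f v - f a\<bar> \<le> e * (v - a)}"
  have aS: "a \<in> S" using assms(1) by (auto simp: S_def)
  have bdd: "bdd_above S" by (rule bdd_aboveI[of _ b]) (auto simp: S_def)
  define c where "c = Sup S"
  have ac: "a \<le> c" unfolding c_def by (rule cSup_upper[OF aS bdd])
  have cb: "c \<le> b" unfolding c_def by (rule cSup_least) (use aS in \<open>auto simp: S_def\<close>)
  have below: "\<bar>f v - f a\<bar> \<le> e * (v - a)" if v: "a \<le> v" "v < c" for v
  proof -
    obtain u where "u \<in> S" "v < u"
      using v less_cSup_iff[OF _ bdd] aS unfolding c_def by blast
    then show ?thesis using v by (auto simp: S_def)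
  qed
  have at_c: "\<bar>f c - f a\<bar> \<le> e * (c - a)"
  proof (cases "a = c")
    case False
    with ac have "a < c" by simp
    have "\<forall>\<^sub>F v in at_left c. \<bar>f v - f a\<bar> \<le> e * (v - a)"
      using eventually_at_left_real[OF \<open>a < c\<close>]
      by eventually_elim (auto intro: below)
    moreover have "((\<lambda>v. \<bar>f v - f a\<bar>) \<longlongrightarrow> \<bar>f c - f a\<bar>) (at_left c)"
      using left[OF \<open>a < c\<close> cb] by (intro tendsto_intros)
    moreover have "((\<lambda>v. e * (v - a)) \<longlongrightarrow> e * (c - a)) (at_left c)"
      by (intro tendsto_intros)
    ultimately show ?thesis
      by (intro tendsto_le[of "at_left c"]) auto
  qed auto
  have cS: "c \<in> S"
    unfolding S_def using ac cb at_c below by (simp add: le_less[of _ c] Ball_def) blast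
  have "c = b"
  proof (rule ccontr)
    assume "c \<noteq> b"
    then have "c < b" using cb by simp
    have "\<forall>\<^sub>F h in at_right 0. dist ((f (c + h) - f c) / h) 0 < e"
      using tendstoD[OF right[OF ac \<open>c < b\<close>] \<open>e > 0\<close>] .
    then obtain d where d: "d > 0"
      "\<And>h. 0 < h \<Longrightarrow> h < d \<Longrightarrow> \<bar>(f (c + h) - f c) / h\<bar> < e"
      unfolding eventually_at_right_field by auto
    \<comment> \<open>Halving keeps \<open>h\<close> strictly below \<open>d\<close>; the other term
      keeps \<open>c + h\<close> inside the interval.\<close>
    define h where "h = min (d / 2) (b - c)"
    have h: "0 < h" "h < d" "c + h \<le> b" using d \<open>c < b\<close> by (auto simp: h_def)
    have "\<bar>f v - f a\<bar> \<le> e * (v - a)" if v: "a \<le> v" "v \<le> c + h" for v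
    proof (cases "v \<le> c")
      case True
      then show ?thesis using at_c below[of v] v by (cases "v = c") auto
    next
      case False
      then have "\<bar>(f (c + (v - c)) - f c) / (v - c)\<bar> < e" using v h by (intro d) auto
      then have "\<bar>f v - f c\<bar> < e * (v - c)" using False by (simp add: field_simps)
      then show ?thesis using at_c by (simp add: algebra_simps)
    qed
    then have "c + h \<in> S" using h ac by (auto simp: S_def)
    then have "c + h \<le> c" unfolding c_def by (rule cSup_upper[OF _ bdd])
    then show False using h by simp
  qed
  then show ?thesis using at_c by simp
qed

lemma right_derivative_zero_imp_const:
  fixes f :: "real \<Rightarrow> real"
  assumes "a \<le> b"
    and "\<And>u. a \<le> u \<Longrightarrow> u < b \<Longrightarrow> ((\<lambda>h. (f (u + h) - f u) / h) \<longlongrightarrow> 0) (at_right 0)"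
    and "\<And>u. a < u \<Longrightarrow> u \<le> b \<Longrightarrow> (f \<longlongrightarrow> f u) (at_left u)"
  shows "f b = f a"
proof -
  have "\<bar>f b - f a\<bar> \<le> 0 + e" if "e > 0" for e
  proof -
    \<comment> \<open>The added 1 keeps the slope positive and finite even when
      \<open>a = b\<close>, and the product below \<open>e\<close>.\<close>
    have "\<bar>f b - f a\<bar> \<le> e / (b - a + 1) * (b - a)"
      using assms \<open>e > 0\<close> by (intro right_derivative_zero_le) auto
    also have "\<dots> \<le> e" using assms(1) that by (simp add: field_simps)
    finally show ?thesis by simp
  qed
  then have "\<bar>f b - f a\<bar> \<le> 0" by (rule field_le_epsilon)
  then show ?thesis by simp
qed

section \<open>Stopped and bumped paths\<close>

lemma stopped_stopped: "stopped (stopped x s) t = stopped x (min s t)"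
  by (simp add: stopped_def min.assoc min.commute[of t])

lemma left_lim_cong:
  assumes "0 < t" and "\<And>s. s < t \<Longrightarrow> x s = y s"
  shows "left_lim x t = left_lim y t"
proof -
  \<comment> \<open>\<open>Lim\<close> is a definite description, so it suffices that the same
    values \<open>l\<close> qualify for both paths.\<close>
  have "(x \<longlongrightarrow> l) (at_left t) \<longleftrightarrow> (y \<longlongrightarrow> l) (at_left t)" for l
    by (intro tendsto_cong eventually_at_leftI[of 0]) (use assms in auto)
  then show ?thesis using assms(1) by (simp add: left_lim_def Topological_Spaces.Lim_def)
qed

lemma left_lim_const:
  assumes "a < t" "0 < t" and "\<And>s. a \<le> s \<Longrightarrow> s < t \<Longrightarrow> x s = c"
  shows "left_lim x t = c"
proof -
  have "(x \<longlongrightarrow> c) (at_left t)"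
    by (rule tendsto_eventually, rule eventually_at_leftI[of a]) (use assms in auto)
  then show ?thesis using assms(2)
    by (simp add: left_lim_def tendsto_Lim trivial_limit_at_left_real)
qed

text \<open>Relates the left-stopped path at the end of a flat stretch to the path at its start, so
  that only time has passed between the two.\<close>

lemma stopped_left_const:
  assumes "a < b" "0 < b" and "\<And>s. a \<le> s \<Longrightarrow> s < b \<Longrightarrow> x s = x a"
  shows "stopped_left x b = stopped x a"
proof -
  have "left_lim x b = x a" using assms by (rule left_lim_const)
  moreover have "(if s < b then x s else x a) = x (min s a)" for s
    using assms(1) assms(3)[of s] by (cases "s \<le> a") (simp_all add: min_def)
  ultimately show ?thesis unfolding stopped_left_def stopped_def by presburger
qed

lemma stopped_stopped_left: "stopped (stopped_left x t) t = stopped_left x t"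
  by (auto simp: stopped_left_def stopped_def min_def)

lemma stopped_bump: "stopped (bump (stopped x t) t e) t = bump (stopped x t) t e"
  by (auto simp: bump_def stopped_def min_def indicator_def)

lemma bump_bump: "bump (bump x t e) t e' = bump x t (e + e')"
  by (auto simp: bump_def algebra_simps)

lemma bump_zero: "bump x t 0 = x"
  by (auto simp: bump_def)

text \<open>A bump at \<open>t\<close> is invisible before \<open>t\<close>, so a strictly causal
  gradient takes the same value at all bumps. At time 0 this would fail, because
  \<open>left_lim\<close> is then the value itself.\<close>

lemma stopped_left_bump:
  assumes "0 < t"
  shows "stopped_left (bump (stopped x t) t e) t = stopped_left x t"
proof -
  have "left_lim (bump (stopped x t) t e) t = left_lim x t"
    using assms by (intro left_lim_cong) (auto simp: bump_def stopped_def)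
  then show ?thesis by (auto simp: stopped_left_def bump_def stopped_def)
qed

text \<open>Explains \<open>- jump x t\<close> in genericity: removing the jump is an admissible
  bump, which puts left-stopped paths into \<Omega>.\<close>

lemma bump_minus_jump: "bump (stopped x t) t (- jump x t) = stopped_left x t"
  by (auto simp: bump_def stopped_def stopped_left_def jump_def indicator_def)

section \<open>Space gradients as derivatives along bumps\<close>

lemma has_space_grad_unique:
  assumes "has_space_grad F g p" "has_space_grad F g' p"
  shows "g = g'"
proof -
  obtain t y where "p = (t, y)" by (cases p)
  with assms have "(\<lambda>h. h \<bullet> g) = (\<lambda>h. h \<bullet> g')"
    by (intro has_derivative_unique[of "\<lambda>e. F (t, bump y t e)" _ 0])
      (auto simp: has_space_grad_def gderiv_def)
  then have "\<forall>h. h \<bullet> g = h \<bullet> g'" by (simp add: fun_eq_iff)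
  then show ?thesis by (simp only: vector_eq_ldot)
qed

text \<open>Bumps at the same time add up, so the derivative at \<open>e\<close> is a translate of
  the derivative at 0 taken at the bumped path.\<close>

lemma has_space_grad_bump:
  assumes "has_space_grad F g (t, bump x t e)"
  shows "GDERIV (\<lambda>e. F (t, bump x t e)) e :> g"
proof -
  have "((\<lambda>e'. F (t, bump x t (e + e'))) has_derivative (\<lambda>h. h \<bullet> g)) (at 0)"
    using assms by (simp add: has_space_grad_def gderiv_def bump_bump)
  moreover have "((\<lambda>e'. e' - e) has_derivative (\<lambda>h. h)) (at e)"
    by (auto intro!: derivative_eq_intros)
  ultimately have "((\<lambda>e'. F (t, bump x t (e + (e' - e)))) has_derivative (\<lambda>h. h \<bullet> g)) (at e)"
    using has_derivative_compose[of "\<lambda>e'. e' - e" "\<lambda>h. h" e UNIV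
        "\<lambda>e'. F (t, bump x t (e + e'))" "\<lambda>h. h \<bullet> g"] by simp
  then show ?thesis by (simp add: gderiv_def)
qed

lemma GDERIV_line:
  assumes "GDERIV f (s *\<^sub>R v) :> g"
  shows "((\<lambda>s. f (s *\<^sub>R v)) has_real_derivative v \<bullet> g) (at s)"
proof -
  have "((\<lambda>s. s *\<^sub>R v) has_derivative (\<lambda>h. h *\<^sub>R v)) (at s)"
    by (auto intro!: derivative_eq_intros)
  from has_derivative_compose[OF this, of f "\<lambda>h. h \<bullet> g"] assms
  have "((\<lambda>s. f (s *\<^sub>R v)) has_derivative (\<lambda>h. (h *\<^sub>R v) \<bullet> g)) (at s)"
    by (simp add: gderiv_def)
  then show ?thesis
    by (simp add: has_field_derivative_def mult.commute[of _ "v \<bullet> g"])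
qed

section \<open>Closure properties of generic sets\<close>

lemma generic_bump:
  assumes "generic P k \<Omega>" "x \<in> \<Omega>" "0 \<le> t"
  obtains U where "convex U" "0 \<in> interior U" "- jump x t \<in> U"
    "\<And>e. e \<in> U \<Longrightarrow> bump (stopped x t) t e \<in> \<Omega>"
  using assms unfolding generic_def by meson

lemma generic_stopped:
  assumes "generic P k \<Omega>" "x \<in> \<Omega>" "0 \<le> t"
  shows "stopped x t \<in> \<Omega>" "stopped_left x t \<in> \<Omega>"
proof -
  obtain U where U: "0 \<in> interior U" "- jump x t \<in> U"
    "\<And>e. e \<in> U \<Longrightarrow> bump (stopped x t) t e \<in> \<Omega>"
    using generic_bump[OF assms] by metis
  show "stopped x t \<in> \<Omega>"
    using U(3)[of 0] U(1) interior_subset[of U] by (auto simp: bump_zero)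
  show "stopped_left x t \<in> \<Omega>"
    using U(3)[OF U(2)] by (simp add: bump_minus_jump)
qed

lemma stopped_in_Lambda: "x \<in> \<Omega> \<Longrightarrow> 0 \<le> t \<Longrightarrow> (t, stopped x t) \<in> Lambda \<Omega>"
  by (auto simp: Lambda_def)

section \<open>Functionals of class M along flat stretches and across jumps\<close>

context
  fixes P :: "nat \<Rightarrow> nat \<Rightarrow> real" and k :: "nat \<Rightarrow> nat"
    and \<Omega> :: "('m::finite) rpath set" and M :: "real \<times> 'm rpath \<Rightarrow> real"
  assumes gen: "generic P k \<Omega>" and M: "M \<in> class_M P k \<Omega>"
begin

lemma class_M_time_deriv:
  assumes "p \<in> Lambda \<Omega>"
  shows "has_time_deriv M 0 p"
proof -
  obtain d where d: "has_time_deriv M d p"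
    using M assms by (auto simp: class_M_def differentiable_functional_def)
  then have "time_deriv M p = d"
    unfolding time_deriv_def has_time_deriv_def
    by (intro the_equality) (auto intro: tendsto_unique[rotated])
  then show ?thesis using d M assms by (simp add: class_M_def)
qed

lemma class_M_space_grad:
  assumes "p \<in> Lambda \<Omega>"
  shows "has_space_grad M (space_grad M p) p"
proof -
  obtain g where g: "has_space_grad M g p"
    using M assms by (auto simp: class_M_def differentiable_functional_def)
  then have "space_grad M p = g"
    unfolding space_grad_def by (blast intro: the_equality has_space_grad_unique)
  then show ?thesis using g by simp
qed

text \<open>As a function of time alone, \<open>M (u, x)\<close> has right derivative 0. Its left
  continuity in \<open>u\<close> comes from the left-continuity of the functional, because
  \<open>x\<close> has no jump after \<open>a\<close>.\<close>

lemma class_M_flat: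
  assumes "x \<in> \<Omega>" "stopped x a = x" "0 \<le> a" "a \<le> b"
  shows "M (b, x) = M (a, x)"
proof (rule right_derivative_zero_imp_const[OF \<open>a \<le> b\<close>])
  have flat: "stopped x u = x" if "a \<le> u" for u
    using stopped_stopped[of x a u] assms(2) that by (simp add: min_def)
  show "((\<lambda>h. (M (u + h, x) - M (u, x)) / h) \<longlongrightarrow> 0) (at_right 0)" if "a \<le> u" for u
    using class_M_time_deriv[OF stopped_in_Lambda[OF assms(1), of u]] that assms(3) flat[OF that]
    by (simp add: has_time_deriv_def)
  show "((\<lambda>u. M (u, x)) \<longlongrightarrow> M (u, x)) (at_left u)" if "a < u" for u
  proof -
    have const: "x s = x a" if "a \<le> s" for s
      using fun_cong[OF assms(2), of s] that by (simp add: stopped_def)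
    have "stopped_left x u = stopped x a"
      using \<open>a < u\<close> _ const by (rule stopped_left_const) (use that assms(3) in simp)
    then have left: "stopped_left x u = x" using assms(2) by simp
    have within: "at u within {0..<u} = at_left u"
    proof -
      have "{0..<u} - {u} = {0..u} - {u}" by auto
      then have "at u within {0..<u} = at u within {0..u}" by (simp add: at_within_def)
      then show ?thesis using that assms(3) by (simp add: at_within_Icc_at_left)
    qed
    have "((\<lambda>s. M (s, stopped x s)) \<longlongrightarrow> M (u, stopped_left x u)) (at u within {0..<u})"
      using M assms(1,3) that unfolding class_M_def left_cont_def by simp
    then have "((\<lambda>s. M (s, stopped x s)) \<longlongrightarrow> M (u, x)) (at_left u)"
      unfolding within left .
    moreover have "\<forall>\<^sub>F s in at_left u. M (s, stopped x s) = M (s, x)"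
      by (rule eventually_at_leftI[of a]) (use that flat in auto)
    ultimately show ?thesis by (rule Lim_transform_eventually)
  qed
qed

text \<open>By strict causality the gradient is the same at every bump in \<open>U\<close>, so
  \<open>M\<close> is affine on the segment from the bump 0, which is the stopped path, to
  \<open>- jump x t\<close>, which is the left-stopped path.\<close>

lemma class_M_jump:
  assumes "x \<in> \<Omega>" "0 < t"
  shows "M (t, stopped x t) - M (t, stopped_left x t)
    = jump x t \<bullet> space_grad M (t, stopped_left x t)"
proof -
  obtain U where U: "convex U" "0 \<in> interior U" "- jump x t \<in> U"
    "\<And>e. e \<in> U \<Longrightarrow> bump (stopped x t) t e \<in> \<Omega>"
    using generic_bump[OF gen assms(1)] assms(2) by (metis less_imp_le)
  define g where "g = space_grad M (t, stopped_left x t)"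
  define f where "f = (\<lambda>e. M (t, bump (stopped x t) t e))"
  have f: "GDERIV f e :> g" if "e \<in> U" for e
  proof -
    let ?z = "bump (stopped x t) t e"
    have z: "?z \<in> \<Omega>" using U that by blast
    have "space_grad M (t, stopped ?z t) = space_grad M (t, stopped_left ?z t)"
      using M z assms(2) by (auto simp: class_M_def strictly_causal_def)
    then have "space_grad M (t, ?z) = g"
      using assms(2) by (simp add: g_def stopped_bump stopped_left_bump)
    moreover have "(t, ?z) \<in> Lambda \<Omega>"
      using stopped_in_Lambda[OF z, of t] assms(2) by (simp add: stopped_bump)
    ultimately show ?thesis
      unfolding f_def using class_M_space_grad has_space_grad_bump by metis
  qed
  \<comment> \<open>Convexity of \<open>U\<close> keeps the whole segment admissible.\<close>
  have seg: "s *\<^sub>R (- jump x t) \<in> U" if "0 \<le> s" "s \<le> 1" for s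
    using convexD[OF U(1) subsetD[OF interior_subset U(2)] U(3), of "1 - s" s] that by simp
  have deriv: "((\<lambda>s. f (s *\<^sub>R (- jump x t))) has_real_derivative (- jump x t) \<bullet> g) (at s)"
    if "0 \<le> s" "s \<le> 1" for s
    by (rule GDERIV_line) (intro f seg that)
  \<comment> \<open>The derivative is constant on the segment, so the intermediate point of the mean
    value theorem drops out and the identity is exact.\<close>
  have "\<exists>z. f (1 *\<^sub>R (- jump x t)) - f (0 *\<^sub>R (- jump x t)) = (1 - 0) * ((- jump x t) \<bullet> g)"
    using MVT2[of 0 1 "\<lambda>s. f (s *\<^sub>R (- jump x t))", OF _ deriv] by auto
  then have "f (- jump x t) - f 0 = - (jump x t \<bullet> g)" by simp
  then show ?thesis by (simp add: f_def g_def bump_zero bump_minus_jump)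
qed

section \<open>Consequences of having no loss at time \<open>T\<close>\<close>

context
  fixes T :: real
  assumes no_loss: "\<And>x. x \<in> \<Omega> \<Longrightarrow> M (0, stopped x 0) \<le> M (T, stopped x T)"
begin

text \<open>The absence of a loss is assumed for all of \<Omega>, so it can be tested on a
  competitor \<open>z\<close>: the left-stopped path with a small jump along \<open>- g\<close> at
  \<open>t\<close>, frozen from then on.\<close>

lemma no_loss_imp_space_grad_eq_0:
  assumes "x \<in> \<Omega>" "0 < t" "t \<le> T" and init: "M (t, stopped_left x t) = M (0, stopped x 0)"
  shows "space_grad M (t, stopped_left x t) = 0"
proof (rule ccontr)
  define w where "w = stopped_left x t"
  define g where "g = space_grad M (t, w)"
  assume "space_grad M (t, stopped_left x t) \<noteq> 0"
  then have "g \<noteq> 0" by (simp add: g_def w_def)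
  have w: "w \<in> \<Omega>" "stopped w t = w"
    using generic_stopped(2)[OF gen assms(1)] assms(2)
    by (auto simp: w_def stopped_stopped_left)
  obtain U where U: "0 \<in> interior U" "\<And>e. e \<in> U \<Longrightarrow> bump w t e \<in> \<Omega>"
    using generic_bump[OF gen w(1), of t] assms(2) w(2) by (metis less_imp_le)
  have "has_space_grad M g (t, bump w t (0 *\<^sub>R (- g)))"
    using class_M_space_grad[OF stopped_in_Lambda[OF w(1), of t]] assms(2)
    by (simp add: g_def w(2) bump_zero)
  then have "((\<lambda>s. M (t, bump w t (s *\<^sub>R (- g)))) has_real_derivative (- g) \<bullet> g) (at 0)"
    by (intro GDERIV_line has_space_grad_bump)
  moreover have "(- g) \<bullet> g < 0" using \<open>g \<noteq> 0\<close> by simp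
  ultimately have "\<exists>d>0. \<forall>h>0. h < d \<longrightarrow>
      M (t, bump w t ((0 + h) *\<^sub>R (- g))) < M (t, bump w t (0 *\<^sub>R (- g)))"
    by (rule DERIV_neg_dec_right)
  then obtain d where d: "d > 0"
    "\<And>s. 0 < s \<Longrightarrow> s < d \<Longrightarrow> M (t, bump w t (s *\<^sub>R (- g))) < M (t, w)"
    unfolding add_0_left scaleR_zero_left bump_zero by blast
  \<comment> \<open>The step size \<open>s\<close> has to meet two demands: the bump stays in
    \<open>U\<close>, so that the competitor lies in \<Omega>, and \<open>s < d\<close>, so that
    \<open>M\<close> strictly decreases.\<close>
  have "((\<lambda>s. s *\<^sub>R (- g)) \<longlongrightarrow> 0 *\<^sub>R (- g)) (at_right 0)"
    by (intro tendsto_intros)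
  then have "\<forall>\<^sub>F s in at_right 0. s *\<^sub>R (- g) \<in> interior U"
    using U(1) by (intro topological_tendstoD) auto
  moreover have "\<forall>\<^sub>F s in at_right 0. s \<in> {0<..<d}"
    using d(1) by (rule eventually_at_right_real)
  ultimately have "\<forall>\<^sub>F s in at_right 0. s *\<^sub>R (- g) \<in> interior U \<and> s \<in> {0<..<d}"
    by (rule eventually_conj)
  then obtain s where s: "s *\<^sub>R (- g) \<in> interior U" "s \<in> {0<..<d}"
    using eventually_happens'[of "at_right (0::real)"] by auto
  define z where "z = bump w t (s *\<^sub>R (- g))"
  have z: "z \<in> \<Omega>" unfolding z_def using U(2) s interior_subset by blast
  have zt: "stopped z t = z" unfolding z_def using stopped_bump[of w t] w(2) by metis
  \<comment> \<open>The competitor differs from \<open>x\<close> only from \<open>t > 0\<close> on,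
    so both have the same initial value.\<close>
  have "stopped z 0 = stopped x 0"
    using assms(2) by (auto simp: stopped_def z_def w_def bump_def stopped_left_def fun_eq_iff)
  then have "M (0, stopped x 0) \<le> M (T, stopped z T)"
    using no_loss[OF z] by simp
  also have "stopped z T = z"
    using stopped_stopped[of z t T] zt assms(3) by (simp add: min_def)
  also have "M (T, z) = M (t, z)"
    by (rule class_M_flat[OF z zt]) (use assms(2,3) in simp_all)
  also have "\<dots> < M (t, w)"
    using d(2)[of s] s by (simp add: z_def)
  finally show False using init by (simp add: w_def)
qed

text \<open>Flatness brings the initial value up to just before \<open>b\<close>; there the gradient
  vanishes, so a jump at \<open>b\<close>, of whatever size, contributes nothing.\<close>

lemma no_loss_flat_step:
  assumes "x \<in> \<Omega>" "0 \<le> a" "a < b" "b \<le> T"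
    and const: "\<And>s. a \<le> s \<Longrightarrow> s < b \<Longrightarrow> x s = x a"
    and init: "M (a, stopped x a) = M (0, stopped x 0)"
  shows "M (b, stopped x b) = M (0, stopped x 0)"
proof -
  have "stopped_left x b = stopped x a"
    using assms(3) _ const by (rule stopped_left_const) (use assms(2,3) in simp)
  moreover have "M (b, stopped x a) = M (a, stopped x a)"
    using assms(1-3) generic_stopped(1)[OF gen]
    by (intro class_M_flat) (simp_all add: stopped_stopped)
  ultimately have left: "M (b, stopped_left x b) = M (0, stopped x 0)"
    using init by simp
  then have "space_grad M (b, stopped_left x b) = 0"
    using assms(1-4) by (intro no_loss_imp_space_grad_eq_0) simp_all
  then show ?thesis using class_M_jump[OF assms(1), of b] left assms(2,3) by simp
qed

lemma no_loss_piecewise_const: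
  assumes "x \<in> \<Omega>" "0 \<le> T" "p 0 = 0" "T \<le> p N"
    and mono: "\<And>i. i < N \<Longrightarrow> p i < p (Suc i)"
    and const: "\<And>i s. i < N \<Longrightarrow> p i \<le> s \<Longrightarrow> s < p (Suc i) \<Longrightarrow> s < T \<Longrightarrow> x s = x (p i)"
  shows "M (T, stopped x T) = M (0, stopped x 0)"
proof -
  \<comment> \<open>Partition points are capped at \<open>T\<close>: the cell containing
    \<open>T\<close> is cut there, and later steps of the induction are trivial.\<close>
  have "i \<le> N \<Longrightarrow> 0 \<le> p i \<and> M (min (p i) T, stopped x (min (p i) T)) = M (0, stopped x 0)" for i
  proof (induction i)
    case 0
    then show ?case using assms(2,3) by simp
  next
    case (Suc i)
    then have IH: "0 \<le> p i" "M (min (p i) T, stopped x (min (p i) T)) = M (0, stopped x 0)"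
      by simp_all
    have lt: "p i < p (Suc i)" using mono[of i] Suc.prems by simp
    show ?case
    proof (cases "p i < T")
      case True
      have "M (min (p (Suc i)) T, stopped x (min (p (Suc i)) T)) = M (0, stopped x 0)"
      proof (rule no_loss_flat_step[OF assms(1) IH(1)])
        show "x s = x (p i)" if "p i \<le> s" "s < min (p (Suc i)) T" for s
          by (rule const) (use that Suc.prems in simp_all)
      qed (use True IH(2) lt in simp_all)
      then show ?thesis using IH lt by simp
    next
      case False
      then show ?thesis using IH lt by (simp add: min_absorb2)
    qed
  qed
  from this[of N] show ?thesis using assms(4) by simp
qed

end

end

section \<open>Partition cells and approximating paths\<close>

lemma partition_less:
  fixes p :: "nat \<Rightarrow> real"
  assumes "\<And>i. i < N \<Longrightarrow> p i < p (Suc i)" "i < j" "j \<le> N"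
  shows "p i < p j"
  using assms(2,3)
proof (induction j)
  case (Suc j)
  then show ?case using assms(1)[of j] by (cases "i = j") auto
qed simp

lemma approx_path_eq:
  assumes part: "\<And>i. i < k n \<Longrightarrow> P n i < P n (Suc i)"
    and i: "i < k n" and s: "P n i \<le> s" "s < P n (Suc i)"
  shows "approx_path P k x n s = x (P n (Suc i))"
proof -
  \<comment> \<open>The cells are disjoint, so only the \<open>i\<close>-th summand
    survives.\<close>
  have "s \<notin> {P n j..<P n (Suc j)}" if "j < k n" "j \<noteq> i" for j
  proof (cases "j < i")
    case True
    then have "P n (Suc j) \<le> P n i"
      using partition_less[of "k n" "P n" "Suc j" i, OF part] i by (cases "Suc j = i") auto
    then show ?thesis using s by auto
  next
    case False
    then have "P n (Suc i) \<le> P n j"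
      using partition_less[of "k n" "P n" "Suc i" j, OF part] that by (cases "Suc i = j") auto
    then show ?thesis using s by auto
  qed
  then have "approx_path P k x n s = (\<Sum>j<k n. if j = i then x (P n (Suc i)) else 0)"
    unfolding approx_path_def using s by (intro sum.cong) auto
  also have "\<dots> = x (P n (Suc i))" using i by simp
  finally show ?thesis .
qed

lemma prev_point_le:
  assumes "0 \<le> t"
  shows "prev_point P k t n \<le> t"
proof (cases "\<exists>i\<le>k n. P n i < t")
  case True
  let ?S = "{P n i | i. i \<le> k n \<and> P n i < t}"
  have "finite ?S" by simp
  moreover have "?S \<noteq> {}" using True by blast
  ultimately have "Max ?S \<in> ?S" by (rule Max_in)
  then show ?thesis using True by (auto simp: prev_point_def)
qed (use assms in \<open>auto simp: prev_point_def\<close>)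

text \<open>The third clause of right-continuity applies to the constant sequence \<open>t\<close>,
  since the preceding partition point never exceeds \<open>t\<close>.\<close>

lemma right_cont_approx_path:
  assumes "right_cont P k \<Omega> F" "x \<in> \<Omega>" "0 \<le> t"
  shows "(\<lambda>n. F (t, stopped (approx_path P k x n) t)) \<longlonglongrightarrow> F (t, stopped x t)"
proof -
  have "(\<lambda>n. F (\<tau> n, stopped (approx_path P k x n) (\<tau> n))) \<longlonglongrightarrow> F (t, stopped x t)"
    if "\<forall>n. 0 \<le> \<tau> n" "\<tau> \<longlonglongrightarrow> t" "\<forall>\<^sub>F n in sequentially. \<tau> n \<ge> prev_point P k t n" for \<tau>
    using assms that unfolding right_cont_def by blast
  from this[of "\<lambda>_. t"] show ?thesis using assms(3) by (simp add: prev_point_le)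
qed

theorem theorem5p13:
  fixes P :: "nat \<Rightarrow> nat \<Rightarrow> real" and k :: "nat \<Rightarrow> nat"
    and \<Omega> :: "('m::finite) rpath set"
    and M :: "real \<times> 'm rpath \<Rightarrow> real"
    and T :: real
  assumes "partition_seq P k"
    and "generic P k \<Omega>"
    and "M \<in> class_M P k \<Omega>"
    and "T > 0"
    and "\<forall>x\<in>\<Omega>. M (T, stopped x T) - M (0, stopped x 0) \<ge> 0"
  shows "\<forall>x\<in>\<Omega>. M (T, stopped x T) = M (0, stopped x 0)"
proof
  fix x assume x: "x \<in> \<Omega>"
  have part: "P n 0 = 0" "\<And>i. i < k n \<Longrightarrow> P n i < P n (Suc i)" for n
    using assms(1) by (auto simp: partition_seq_def)
  have "\<forall>\<^sub>F n in sequentially. T \<le> P n (k n)"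
    using assms(1) by (auto simp: partition_seq_def filterlim_at_top)
  moreover have "\<forall>\<^sub>F n in sequentially. stopped (approx_path P k x n) T \<in> \<Omega>"
    using assms(2,4) x by (auto simp: generic_def eventually_sequentially)
  \<comment> \<open>For large \<open>n\<close> the partition reaches \<open>T\<close> and the
    approximation stopped at \<open>T\<close> belongs to \<Omega>; it is then a piecewise constant
    path to which the previous argument applies.\<close>
  ultimately have eq: "\<forall>\<^sub>F n in sequentially.
    M (T, stopped (approx_path P k x n) T) = M (0, stopped (approx_path P k x n) 0)"
  proof eventually_elim
    case (elim n)
    let ?y = "stopped (approx_path P k x n) T"
    have const: "?y s = ?y (P n i)" if "i < k n" "P n i \<le> s" "s < P n (Suc i)" "s < T" for i s
      using approx_path_eq[of k n P i _ x, OF part(2) that(1)] that by (simp add: stopped_def)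
    have "M (T, stopped ?y T) = M (0, stopped ?y 0)"
      by (rule no_loss_piecewise_const[OF assms(2,3) _ elim(2) _ part(1) elim(1) part(2) const])
        (use assms(4,5) in simp_all)
    then show ?case using assms(4) by (simp add: stopped_stopped)
  qed
  \<comment> \<open>Needed at 0 as well as at \<open>T\<close>: the approximation starts at the
    value of \<open>x\<close> at the first positive partition point, so its initial value also has
    to converge.\<close>
  have cont: "(\<lambda>n. M (t, stopped (approx_path P k x n) t)) \<longlonglongrightarrow> M (t, stopped x t)" if "0 \<le> t" for t
    using assms(3) x that by (intro right_cont_approx_path[of P k \<Omega>]) (auto simp: class_M_def)
  have "(\<lambda>n. M (0, stopped (approx_path P k x n) 0)) \<longlonglongrightarrow> M (T, stopped x T)"
    using Lim_transform_eventually[OF cont eq] assms(4) by simp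
  then show "M (T, stopped x T) = M (0, stopped x 0)"
    using cont[of 0] LIMSEQ_unique by blast
qed

end
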